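(* For every integer $n\ge 1$, the subalgebra of $R_n$ generated by the quasisymmetric invariants $\{F_{1^r} : r\ge 0\}$ is commutative.
   Context: Let $R_n=\mathbb{Q}[\theta_1,\dots,\theta_n]$ be the polynomial ring in anticommuting variables over $\mathbb{Q}$ (the exterior algebra on $n$ generators): $\theta_i\theta_j=-\theta_j\theta_i$ for $i\ne j$ and $\theta_i^2=0$. For $A=\{a_1<\cdots<a_r\}\subseteq [n]=\{1,\dots,n\}$ put $\theta_A=\theta_{a_1}\cdots\theta_{a_r}$. For $r\ge 0$ define $F_{1^r}=\sum_{A\subseteq[n],\,|A|=r}\theta_A$ (so $F_{1^0}=1$ and $F_{1^r}=0$ if $r>n$). These elements linearly span the quasisymmetric invariants of $R_n$. *)

theory Defs
  imports "HOL-Algebra.Algebra" "HOL-Library.Poly_Mapping"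
begin

text \<open>
  Words under concatenation, written additively: with this instance the convolution product that
  the library puts on finitely supported functions makes \<^typ>\<open>nat list \<Rightarrow>\<^sub>0 rat\<close> the free
  associative unital algebra over the rationals on countably many letters.
\<close>

instantiation list :: (type) monoid_add
begin

definition zero_list :: "'a list" where "zero_list = []"

definition plus_list :: "'a list \<Rightarrow> 'a list \<Rightarrow> 'a list" where "plus_list xs ys = xs @ ys"

instance by standard (simp_all add: zero_list_def plus_list_def)

end

definition free_alg :: "nat \<Rightarrow> (nat list \<Rightarrow>\<^sub>0 rat) ring" where
  "free_alg n = \<lparr>carrier = {p. Poly_Mapping.keys p \<subseteq> lists {1..n}},
                 monoid.mult = (*), one = 1, ring.zero = 0, add = (+)\<rparr>"

abbreviation letter :: "nat \<Rightarrow> nat list \<Rightarrow>\<^sub>0 rat" where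
  "letter i \<equiv> Poly_Mapping.single [i] 1"

definition anticomm_relations :: "nat \<Rightarrow> (nat list \<Rightarrow>\<^sub>0 rat) set" where
  "anticomm_relations n =
     {letter i * letter j + letter j * letter i | i j. i \<in> {1..n} \<and> j \<in> {1..n} \<and> i \<noteq> j} \<union>
     {letter i * letter i | i. i \<in> {1..n}}"

definition anticomm_ideal :: "nat \<Rightarrow> (nat list \<Rightarrow>\<^sub>0 rat) set" where
  "anticomm_ideal n = Idl\<^bsub>free_alg n\<^esub> (anticomm_relations n)"

text \<open>
  The exterior algebra on $n$ generators over the rationals, by generators and relations.
  Its elements are cosets in the free algebra.
\<close>

definition anticomm_ring :: "nat \<Rightarrow> (nat list \<Rightarrow>\<^sub>0 rat) set ring" where
  "anticomm_ring n = free_alg n Quot anticomm_ideal n"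

definition theta :: "nat \<Rightarrow> nat \<Rightarrow> (nat list \<Rightarrow>\<^sub>0 rat) set" where
  "theta n i = anticomm_ideal n +>\<^bsub>free_alg n\<^esub> letter i"

definition scalars :: "nat \<Rightarrow> (nat list \<Rightarrow>\<^sub>0 rat) set set" where
  "scalars n = range (\<lambda>c::rat. anticomm_ideal n +>\<^bsub>free_alg n\<^esub> Poly_Mapping.single [] c)"

definition theta_set :: "nat \<Rightarrow> nat set \<Rightarrow> (nat list \<Rightarrow>\<^sub>0 rat) set" where
  "theta_set n A =
     foldr (\<otimes>\<^bsub>anticomm_ring n\<^esub>) (map (theta n) (sorted_list_of_set A)) \<one>\<^bsub>anticomm_ring n\<^esub>"

definition F_ones :: "nat \<Rightarrow> nat \<Rightarrow> (nat list \<Rightarrow>\<^sub>0 rat) set" where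
  "F_ones n r =
     finsum (anticomm_ring n) (theta_set n) {A. A \<subseteq> {1..n} \<and> card A = r}"

text \<open>
  The library locale \<^locale>\<open>subalgebra\<close> only asks for an additive subgroup closed under
  multiplication by the scalars, i.e. for a linear subspace; closure under products and the unit
  come from \<^locale>\<open>subring\<close>.
\<close>

definition generated_subalgebra ::
    "nat \<Rightarrow> (nat list \<Rightarrow>\<^sub>0 rat) set set \<Rightarrow> (nat list \<Rightarrow>\<^sub>0 rat) set set" where
  "generated_subalgebra n S =
     \<Inter>{V. subring V (anticomm_ring n) \<and> subalgebra (scalars n) V (anticomm_ring n) \<and> S \<subseteq> V}"

lemma ring_free_alg: "ring (free_alg n)"
proof (rule ringI)
  have add: "p + q \<in> carrier (free_alg n)"
    if "p \<in> carrier (free_alg n)" "q \<in> carrier (free_alg n)" for p q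
    using that keys_add[of p q] by (auto simp: free_alg_def)
  have mult: "p * q \<in> carrier (free_alg n)"
    if "p \<in> carrier (free_alg n)" "q \<in> carrier (free_alg n)" for p q
    using that keys_mult[of p q] by (fastforce simp: free_alg_def plus_list_def)
  show "abelian_group (free_alg n)"
  proof (rule abelian_groupI)
    fix p assume "p \<in> carrier (free_alg n)"
    then show "\<exists>q\<in>carrier (free_alg n). q \<oplus>\<^bsub>free_alg n\<^esub> p = \<zero>\<^bsub>free_alg n\<^esub>"
      by (intro bexI[of _ "- p"]) (auto simp: free_alg_def)
  qed (use add in \<open>auto simp: free_alg_def algebra_simps\<close>)
  show "Group.monoid (free_alg n)"
  proof (rule monoidI)
    show "\<one>\<^bsub>free_alg n\<^esub> \<in> carrier (free_alg n)"
      by (simp add: free_alg_def zero_list_def)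
  qed (use mult in \<open>auto simp: free_alg_def algebra_simps\<close>)
qed (auto simp: free_alg_def algebra_simps)

lemma letter_closed: "i \<in> {1..n} \<Longrightarrow> letter i \<in> carrier (free_alg n)"
  by (simp add: free_alg_def)

lemma anticomm_relations_closed: "anticomm_relations n \<subseteq> carrier (free_alg n)"
proof -
  interpret ring "free_alg n" by (rule ring_free_alg)
  have "p * q \<in> carrier (free_alg n)" "p + q \<in> carrier (free_alg n)"
    if "p \<in> carrier (free_alg n)" "q \<in> carrier (free_alg n)" for p q
    using m_closed[OF that] a_closed[OF that] by (simp_all add: free_alg_def)
  then show ?thesis
    unfolding anticomm_relations_def using letter_closed by auto
qed

lemma ideal_anticomm_ideal: "ideal (anticomm_ideal n) (free_alg n)"
  unfolding anticomm_ideal_def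
  by (rule ring.genideal_ideal[OF ring_free_alg anticomm_relations_closed])

lemma ring_anticomm_ring: "ring (anticomm_ring n)"
  unfolding anticomm_ring_def by (rule ideal.quotient_is_ring[OF ideal_anticomm_ideal])

lemma ring_hom_coset:
  "ring_hom_ring (free_alg n) (anticomm_ring n) ((+>\<^bsub>free_alg n\<^esub>) (anticomm_ideal n))"
  unfolding anticomm_ring_def by (rule ideal.rcos_ring_hom_ring[OF ideal_anticomm_ideal])

lemma theta_closed: "i \<in> {1..n} \<Longrightarrow> theta n i \<in> carrier (anticomm_ring n)"
  unfolding theta_def
  by (rule ring_hom_closed[OF ring_hom_ring.homh[OF ring_hom_coset]]) (rule letter_closed)

lemma scalars_closed: "scalars n \<subseteq> carrier (anticomm_ring n)"
proof -
  have "Poly_Mapping.single [] c \<in> carrier (free_alg n)" for c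
    by (simp add: free_alg_def)
  then show ?thesis
    unfolding scalars_def by (auto intro: ring_hom_closed[OF ring_hom_ring.homh[OF ring_hom_coset]])
qed

lemma coset_relation:
  assumes "p \<in> anticomm_relations n"
  shows "anticomm_ideal n +>\<^bsub>free_alg n\<^esub> p = \<zero>\<^bsub>anticomm_ring n\<^esub>"
proof -
  interpret I: ideal "anticomm_ideal n" "free_alg n" by (rule ideal_anticomm_ideal)
  have "p \<in> anticomm_ideal n"
    using assms I.genideal_self[OF anticomm_relations_closed]
    by (auto simp: anticomm_ideal_def)
  then show ?thesis
    by (simp add: I.a_rcos_const anticomm_ring_def FactRing_def)
qed

lemma theta_square:
  assumes "i \<in> {1..n}"
  shows "theta n i \<otimes>\<^bsub>anticomm_ring n\<^esub> theta n i = \<zero>\<^bsub>anticomm_ring n\<^esub>"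
proof -
  interpret h: ring_hom_ring "free_alg n" "anticomm_ring n"
      "(+>\<^bsub>free_alg n\<^esub>) (anticomm_ideal n)"
    by (rule ring_hom_coset)
  have "letter i \<otimes>\<^bsub>free_alg n\<^esub> letter i \<in> anticomm_relations n"
    using assms by (auto simp: anticomm_relations_def free_alg_def)
  from coset_relation[OF this] show ?thesis
    using letter_closed[OF assms] by (simp add: theta_def)
qed

lemma theta_anticomm:
  assumes "i \<in> {1..n}" "j \<in> {1..n}" "i \<noteq> j"
  shows "theta n i \<otimes>\<^bsub>anticomm_ring n\<^esub> theta n j =
         \<ominus>\<^bsub>anticomm_ring n\<^esub> (theta n j \<otimes>\<^bsub>anticomm_ring n\<^esub> theta n i)"
proof -
  interpret h: ring_hom_ring "free_alg n" "anticomm_ring n"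
      "(+>\<^bsub>free_alg n\<^esub>) (anticomm_ideal n)"
    by (rule ring_hom_coset)
  have "letter i \<otimes>\<^bsub>free_alg n\<^esub> letter j \<oplus>\<^bsub>free_alg n\<^esub> letter j \<otimes>\<^bsub>free_alg n\<^esub> letter i
          \<in> anticomm_relations n"
    using assms by (auto simp: anticomm_relations_def free_alg_def)
  from coset_relation[OF this]
  have "theta n i \<otimes>\<^bsub>anticomm_ring n\<^esub> theta n j \<oplus>\<^bsub>anticomm_ring n\<^esub>
        theta n j \<otimes>\<^bsub>anticomm_ring n\<^esub> theta n i = \<zero>\<^bsub>anticomm_ring n\<^esub>"
    using letter_closed[OF assms(1)] letter_closed[OF assms(2)] by (simp add: theta_def)
  then show ?thesis
    using theta_closed[OF assms(1)] theta_closed[OF assms(2)]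
    by (intro h.S.minus_equality[symmetric]) auto
qed

lemma theta_set_closed:
  assumes "A \<subseteq> {1..n}"
  shows "theta_set n A \<in> carrier (anticomm_ring n)"
proof -
  interpret ring "anticomm_ring n" by (rule ring_anticomm_ring)
  have *: "foldr (\<otimes>\<^bsub>anticomm_ring n\<^esub>) (map (theta n) xs) \<one>\<^bsub>anticomm_ring n\<^esub>
             \<in> carrier (anticomm_ring n)" if "set xs \<subseteq> {1..n}" for xs
    using that by (induction xs) (auto intro!: m_closed theta_closed)
  have "set (sorted_list_of_set A) \<subseteq> {1..n}"
    using assms finite_subset[OF assms] by simp
  from *[OF this] show ?thesis
    by (simp add: theta_set_def)
qed

lemma F_ones_closed: "F_ones n r \<in> carrier (anticomm_ring n)"
proof -
  interpret ring "anticomm_ring n" by (rule ring_anticomm_ring)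
  show ?thesis
    unfolding F_ones_def by (rule finsum_closed) (use theta_set_closed in blast)
qed

lemma F_ones_0: "F_ones n 0 = \<one>\<^bsub>anticomm_ring n\<^esub>"
proof -
  interpret ring "anticomm_ring n" by (rule ring_anticomm_ring)
  have "{A. A \<subseteq> {1..n} \<and> card A = 0} = {{}}"
    by (auto dest: finite_subset)
  then show ?thesis
    using theta_set_closed[of "{}" n] by (simp add: F_ones_def theta_set_def)
qed

lemma F_ones_eq_zero:
  assumes "r > n"
  shows "F_ones n r = \<zero>\<^bsub>anticomm_ring n\<^esub>"
proof -
  interpret ring "anticomm_ring n" by (rule ring_anticomm_ring)
  have "card A \<le> n" if "A \<subseteq> {1..n}" for A
    using card_mono[OF _ that] by simp
  then have "card A \<noteq> r" if "A \<subseteq> {1..n}" for A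
    using assms that leD by blast
  then have "{A. A \<subseteq> {1..n} \<and> card A = r} = {}"
    by blast
  then show ?thesis
    by (simp only: F_ones_def finsum_empty)
qed

lemma generated_subalgebra:
  assumes "S \<subseteq> carrier (anticomm_ring n)"
  shows "subring (generated_subalgebra n S) (anticomm_ring n)"
    and "subalgebra (scalars n) (generated_subalgebra n S) (anticomm_ring n)"
    and "S \<subseteq> generated_subalgebra n S"
proof -
  interpret ring "anticomm_ring n" by (rule ring_anticomm_ring)
  let ?\<V> = "{V. subring V (anticomm_ring n) \<and> subalgebra (scalars n) V (anticomm_ring n) \<and> S \<subseteq> V}"
  have "carrier (anticomm_ring n) \<in> ?\<V>"
    using assms carrier_is_subring carrier_is_subalgebra[OF scalars_closed] by simp
  then have ne: "?\<V> \<noteq> {}" by blast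
  show "subring (generated_subalgebra n S) (anticomm_ring n)"
    unfolding generated_subalgebra_def
  proof (rule subringI)
    show "\<Inter>?\<V> \<subseteq> carrier (anticomm_ring n)"
      using \<open>carrier (anticomm_ring n) \<in> ?\<V>\<close> by blast
  qed (auto dest: subringE(3,5,6,7))
  have "subgroup (\<Inter>?\<V>) (add_monoid (anticomm_ring n))"
    by (rule add.subgroups_Inter[OF _ ne]) (auto dest: subalgebra.axioms(1))
  then show "subalgebra (scalars n) (generated_subalgebra n S) (anticomm_ring n)"
    unfolding generated_subalgebra_def
    by (auto simp: subalgebra_def subalgebra_axioms_def)
  show "S \<subseteq> generated_subalgebra n S"
    by (auto simp: generated_subalgebra_def)
qed

end

theory Submission
  imports Defs
begin

text \<open>
  Elements of even degree in $\theta$ are central, so only products of two invariants of odd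
  degree matter. The identity $F_{1^{2k+1}} = F_{1^1} F_{1^{2k}}$, proved by induction on the number
  of variables, together with $F_{1^1}^2 = 0$ shows that those products vanish. Hence the generators
  commute, and so does the subalgebra they generate, by taking centralizers twice.
\<close>

section \<open>Ordered sums of anticommuting elements\<close>

text \<open>The sequence runs over all naturals, so no index bounds arise. In
  \<open>x_anticomm\<close> the case \<open>i = j\<close> is consistent because squares vanish;
  conversely, in a general ring it would only give twice the square equal to zero.\<close>

locale anticommuting_sequence = ring R for R (structure) +
  fixes x :: "nat \<Rightarrow> 'a"
  assumes x_closed [simp]: "x i \<in> carrier R"
    and x_anticomm: "x i \<otimes> x j = \<ominus> (x j \<otimes> x i)"
    and x_square: "x i \<otimes> x i = \<zero>"
begin

text \<open>The r-th elementary symmetric sum in \<open>x 1\<close>, ..., \<open>x m\<close>, each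
  product in increasing order of index. The recursion splits the r-subsets by whether they contain
  the largest index \<open>Suc m\<close>, whose factor therefore stands on the right.\<close>

fun ordered_sum :: "nat \<Rightarrow> nat \<Rightarrow> 'a" where
  "ordered_sum m 0 = \<one>"
| "ordered_sum 0 (Suc r) = \<zero>"
| "ordered_sum (Suc m) (Suc r) = ordered_sum m (Suc r) \<oplus> ordered_sum m r \<otimes> x (Suc m)"

lemma ordered_sum_closed [simp]: "ordered_sum m r \<in> carrier R"
  by (induction m r rule: ordered_sum.induct) auto

text \<open>Passing \<open>x i\<close> through r factors costs r signs. A factor equal to
  \<open>x i\<close> makes no exception, since both products are then zero.\<close>

lemma x_ordered_sum:
  "x i \<otimes> ordered_sum m r =
     (if even r then ordered_sum m r \<otimes> x i else \<ominus> (ordered_sum m r \<otimes> x i))"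
proof (induction m r rule: ordered_sum.induct)
  case (3 m r)
  have "x i \<otimes> (ordered_sum m r \<otimes> x (Suc m)) = (x i \<otimes> ordered_sum m r) \<otimes> x (Suc m)"
    by (simp add: m_assoc)
  also have "\<dots> = (if even r then ordered_sum m r \<otimes> (x i \<otimes> x (Suc m))
      else \<ominus> (ordered_sum m r \<otimes> (x i \<otimes> x (Suc m))))"
    by (simp add: 3 m_assoc l_minus)
  \<comment> \<open>Crossing the last factor costs one more sign, so the parity condition
    flips.\<close>
  also have "\<dots> = (if odd r then ordered_sum m r \<otimes> x (Suc m) \<otimes> x i
      else \<ominus> (ordered_sum m r \<otimes> x (Suc m) \<otimes> x i))"
    by (simp add: x_anticomm[of i "Suc m"] m_assoc r_minus)
  finally show ?case
    using 3 by (simp add: r_distr l_distr minus_add)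
qed auto

lemma commute_ordered_sum:
  assumes "z \<in> carrier R" and "\<And>i. z \<otimes> x i = x i \<otimes> z"
  shows "z \<otimes> ordered_sum m r = ordered_sum m r \<otimes> z"
proof (induction m r rule: ordered_sum.induct)
  case (3 m r)
  have "z \<otimes> (ordered_sum m r \<otimes> x (Suc m)) = ordered_sum m r \<otimes> (z \<otimes> x (Suc m))"
    using assms(1) 3 by (simp add: m_assoc[symmetric])
  also have "\<dots> = ordered_sum m r \<otimes> x (Suc m) \<otimes> z"
    using assms by (simp add: m_assoc)
  finally show ?case
    using 3 assms(1) by (simp add: r_distr l_distr)
qed (use assms in auto)

lemma ordered_sum_even_commute:
  "even r \<Longrightarrow> ordered_sum m r \<otimes> ordered_sum k s = ordered_sum k s \<otimes> ordered_sum m r"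
  by (rule commute_ordered_sum) (simp_all add: x_ordered_sum)

text \<open>The squares of the variables vanish and the mixed products cancel in pairs.\<close>

lemma ordered_sum_1_square: "ordered_sum m 1 \<otimes> ordered_sum m 1 = \<zero>"
proof (induction m)
  case (Suc m)
  then show ?case
    using x_ordered_sum[of "Suc m" m 1]
    by (simp add: r_distr l_distr x_square l_neg)
qed simp

text \<open>Each increasing product of 2k+1 variables arises on the right once for every factor that
  can be pulled to the front. The signs alternate starting with plus, and an odd number of them adds
  up to 1.\<close>

lemma ordered_sum_odd:
  "ordered_sum m (Suc (2 * k)) = ordered_sum m 1 \<otimes> ordered_sum m (2 * k)"
proof (induction m arbitrary: k)
  case 0
  then show ?case by simp
next
  case (Suc m)
  show ?case
  proof (cases k)
    case 0
    then show ?thesis by simp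
  next
    case (Suc j)
    let ?e = "ordered_sum m" and ?y = "x (Suc m)"
    \<comment> \<open>The induction hypothesis is used at \<open>j\<close>, the predecessor of
      \<open>k\<close>, and later at \<open>k\<close> itself; hence \<open>k\<close> is arbitrary in
      the induction. Here it produces a factor \<open>?e 1\<close> squared.\<close>
    have "?e 1 \<otimes> ?e (Suc (2 * j)) = \<zero>"
      using Suc.IH[of j] ordered_sum_1_square[of m] by (simp add: m_assoc[symmetric])
    then have 1: "?e 1 \<otimes> (?e (Suc (2 * j)) \<otimes> ?y) = \<zero>"
      by (simp add: m_assoc[symmetric])
    \<comment> \<open>Moving \<open>?y\<close> across the sum of odd degree brings it next to the
      other \<open>?y\<close>.\<close>
    have 2: "?y \<otimes> (?e (Suc (2 * j)) \<otimes> ?y) = \<zero>"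
      using x_ordered_sum[of "Suc m" m "Suc (2 * j)"]
      by (simp add: m_assoc[symmetric] l_minus) (simp add: m_assoc x_square)
    have "ordered_sum (Suc m) 1 \<otimes> ordered_sum (Suc m) (2 * k) =
        (?e 1 \<oplus> ?y) \<otimes> (?e (2 * k) \<oplus> ?e (Suc (2 * j)) \<otimes> ?y)"
      using Suc by simp
    also have "\<dots> = ?e 1 \<otimes> ?e (2 * k) \<oplus> ?y \<otimes> ?e (2 * k)"
      using 1 2 by (simp add: r_distr l_distr)
    \<comment> \<open>\<open>?y\<close> passes the sum of even degree without a sign, which leaves
      exactly the two terms of the recursion.\<close>
    also have "\<dots> = ordered_sum (Suc m) (Suc (2 * k))"
      using Suc.IH[of k] x_ordered_sum[of "Suc m" m "2 * k"] by simp
    finally show ?thesis ..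
  qed
qed

text \<open>Each factor is \<open>?e 1\<close> times a sum of even degree; the latter can be moved
  aside, so that the two copies of \<open>?e 1\<close> meet.\<close>

lemma ordered_sum_odd_mult:
  assumes "odd r" "odd s"
  shows "ordered_sum m r \<otimes> ordered_sum m s = \<zero>"
proof -
  obtain j k where r: "r = Suc (2 * j)" and s: "s = Suc (2 * k)"
    using assms by (auto elim!: oddE)
  let ?e = "ordered_sum m"
  have "?e r \<otimes> ?e s = (?e (2 * j) \<otimes> ?e 1) \<otimes> (?e 1 \<otimes> ?e (2 * k))"
    unfolding r s ordered_sum_odd using ordered_sum_even_commute[of "2 * j" m m 1] by simp
  also have "\<dots> = ?e (2 * j) \<otimes> ((?e 1 \<otimes> ?e 1) \<otimes> ?e (2 * k))"
    by (simp only: m_assoc m_closed ordered_sum_closed)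
  also have "\<dots> = \<zero>"
    by (simp only: ordered_sum_1_square l_null r_null ordered_sum_closed)
  finally show ?thesis .
qed

text \<open>Either one degree is even, or both are odd and both products are zero.\<close>

lemma ordered_sum_commute:
  "ordered_sum m r \<otimes> ordered_sum m s = ordered_sum m s \<otimes> ordered_sum m r"
  by (metis ordered_sum_even_commute ordered_sum_odd_mult)

end

section \<open>Identification of the invariants with ordered sums\<close>

lemma theta_set_insert_Suc:
  assumes "A \<subseteq> {1..m}" and "Suc m \<le> n"
  shows "theta_set n (insert (Suc m) A) = theta_set n A \<otimes>\<^bsub>anticomm_ring n\<^esub> theta n (Suc m)"
proof -
  interpret ring "anticomm_ring n" by (rule ring_anticomm_ring)
  let ?y = "theta n (Suc m)"
  have fin: "finite A"
    using assms(1) finite_subset by blast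
  have "sorted_list_of_set (insert (Suc m) A) = sorted_list_of_set A @ [Suc m]"
    using assms(1) fin by (subst sorted_list_of_set_insert) (auto intro!: sorted_insort_is_snoc)
  \<comment> \<open>The new last letter becomes the start value of the fold and is pulled out by
    associativity. Membership in the carrier is carried along because associativity requires
    it.\<close>
  moreover have "foldr (\<otimes>\<^bsub>anticomm_ring n\<^esub>) (map (theta n) xs) ?y =
      foldr (\<otimes>\<^bsub>anticomm_ring n\<^esub>) (map (theta n) xs) \<one>\<^bsub>anticomm_ring n\<^esub> \<otimes>\<^bsub>anticomm_ring n\<^esub> ?y
    \<and> foldr (\<otimes>\<^bsub>anticomm_ring n\<^esub>) (map (theta n) xs) \<one>\<^bsub>anticomm_ring n\<^esub> \<in> carrier (anticomm_ring n)"
    if "set xs \<subseteq> {1..n}" for xs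
    using that assms(2) by (induction xs) (auto simp: theta_closed m_assoc)
  moreover have "set (sorted_list_of_set A) \<subseteq> {1..n}"
    using assms fin by auto
  ultimately show ?thesis
    using assms(2) by (simp add: theta_set_def theta_closed)
qed

text \<open>Extension by zero to all indices, as the locale demands; zero satisfies its relations
  trivially.\<close>

definition theta_ext :: "nat \<Rightarrow> nat \<Rightarrow> (nat list \<Rightarrow>\<^sub>0 rat) set" where
  "theta_ext n i = (if i \<in> {1..n} then theta n i else \<zero>\<^bsub>anticomm_ring n\<^esub>)"

lemma anticommuting_sequence_theta: "anticommuting_sequence (anticomm_ring n) (theta_ext n)"
proof -
  interpret ring "anticomm_ring n" by (rule ring_anticomm_ring)
  show ?thesis
  proof
    fix i j
    show "theta_ext n i \<otimes>\<^bsub>anticomm_ring n\<^esub> theta_ext n j =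
        \<ominus>\<^bsub>anticomm_ring n\<^esub> (theta_ext n j \<otimes>\<^bsub>anticomm_ring n\<^esub> theta_ext n i)"
      by (cases "i = j")
        (auto simp: theta_ext_def theta_closed theta_square theta_anticomm[of i n j])
  qed (auto simp: theta_ext_def theta_closed theta_square)
qed

text \<open>The ring stays fixed while the induction runs over the number \<open>m\<close> of
  variables used; \<open>m = n\<close> gives \<open>F_ones n r\<close>.\<close>

lemma finsum_theta_set:
  assumes "m \<le> n"
  shows "finsum (anticomm_ring n) (theta_set n) {A. A \<subseteq> {1..m} \<and> card A = r} =
    anticommuting_sequence.ordered_sum (anticomm_ring n) (theta_ext n) m r"
proof -
  interpret theta: anticommuting_sequence "anticomm_ring n" "theta_ext n"
    by (rule anticommuting_sequence_theta)
  show ?thesis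
    using assms
  proof (induction m arbitrary: r)
    case 0
    have "{A. A \<subseteq> {1..0::nat} \<and> card A = r} = (if r = 0 then {{}} else {})"
      by auto
    moreover have "finsum (anticomm_ring n) (theta_set n) {{}} = \<one>\<^bsub>anticomm_ring n\<^esub>"
      using theta_set_closed[of "{}" n] by (simp add: theta_set_def)
    ultimately show ?case
      by (cases r) (simp_all only: theta.ordered_sum.simps theta.finsum_empty
          simp_thms if_True if_False nat.distinct)
  next
    case (Suc m)
    show ?case
    proof (cases r)
      case 0
      have "A \<subseteq> {1..Suc m} \<and> card A = 0 \<longleftrightarrow> A = {}" for A
        by (metis card_0_eq card.empty empty_subsetI finite_atLeastAtMost finite_subset)
      then have "{A. A \<subseteq> {1..Suc m} \<and> card A = 0} = {{}}"
        by simp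
      then show ?thesis
        using theta_set_closed[of "{}" n] 0 by (simp add: theta_set_def)
    next
      case (Suc s)
      let ?R = "anticomm_ring n" and ?P = "\<lambda>m r. {A. A \<subseteq> {1..m} \<and> card A = r}"
      let ?ins = "insert (Suc m)"
      have closed: "theta_set n A \<in> carrier ?R" if "A \<subseteq> {1..Suc m}" for A
        by (rule theta_set_closed) (use that \<open>Suc m \<le> n\<close> in auto)
      have card_ins: "card (?ins A) = Suc (card A)" if "A \<subseteq> {1..m}" for A
        using that finite_subset[OF that] by (subst card_insert_disjoint) auto
      \<comment> \<open>This mirrors the recursion of \<open>ordered_sum\<close>: subsets avoiding
        \<open>Suc m\<close>, and subsets obtained by adding it.\<close>
      have split: "?P (Suc m) r = ?P m r \<union> ?ins ` ?P m s"
      proof (intro equalityI subsetI)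
        fix A assume A: "A \<in> ?P (Suc m) r"
        show "A \<in> ?P m r \<union> ?ins ` ?P m s"
        proof (cases "Suc m \<in> A")
          case True
          then have "A = ?ins (A - {Suc m})" by auto
          moreover have "A - {Suc m} \<in> ?P m s"
            using A True Suc finite_subset[of A "{1..Suc m}"]
            by (auto simp: atLeastAtMostSuc_conv)
          ultimately show ?thesis by blast
        next
          case False
          then show ?thesis
            using A by (auto simp: atLeastAtMostSuc_conv)
        qed
      next
        fix A assume "A \<in> ?P m r \<union> ?ins ` ?P m s"
        then show "A \<in> ?P (Suc m) r"
          using card_ins Suc by (auto simp: atLeastAtMostSuc_conv)
      qed
      have inj: "inj_on ?ins (?P m s)"
        by (rule inj_onI) (auto dest!: insert_ident[THEN iffD1, rotated 2])
      have "finsum ?R (theta_set n) (?P (Suc m) r) =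
          finsum ?R (theta_set n) (?P m r) \<oplus>\<^bsub>?R\<^esub> finsum ?R (theta_set n) (?ins ` ?P m s)"
        unfolding split
        by (rule theta.finsum_Un_disjoint) (auto intro!: closed)
      also have "finsum ?R (theta_set n) (?ins ` ?P m s) =
          finsum ?R (\<lambda>A. theta_set n (?ins A)) (?P m s)"
        by (rule theta.finsum_reindex) (use inj in \<open>auto intro!: closed\<close>)
      also have "\<dots> = finsum ?R (\<lambda>A. theta_set n A \<otimes>\<^bsub>?R\<^esub> theta n (Suc m)) (?P m s)"
        by (rule theta.finsum_cong')
          (use Suc.prems in \<open>auto simp: theta_set_insert_Suc intro!: theta.m_closed closed theta_closed\<close>)
      also have "\<dots> = finsum ?R (theta_set n) (?P m s) \<otimes>\<^bsub>?R\<^esub> theta n (Suc m)"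
        by (rule theta.finsum_ldistr[symmetric])
          (use Suc.prems in \<open>auto intro!: closed theta_closed\<close>)
      also have "theta n (Suc m) = theta_ext n (Suc m)"
        using Suc.prems by (simp add: theta_ext_def)
      finally show ?thesis
        using Suc Suc.IH[of r] Suc.IH[of s] Suc.prems by simp
    qed
  qed
qed

lemma F_ones_commute:
  "F_ones n r \<otimes>\<^bsub>anticomm_ring n\<^esub> F_ones n s = F_ones n s \<otimes>\<^bsub>anticomm_ring n\<^esub> F_ones n r"
  unfolding F_ones_def finsum_theta_set[OF order_refl]
  by (rule anticommuting_sequence.ordered_sum_commute[OF anticommuting_sequence_theta])

section \<open>Scalars, centralizers and generated subalgebras\<close>

lemma single_Nil_commute:
  fixes p :: "nat list \<Rightarrow>\<^sub>0 rat"
  shows "Poly_Mapping.single [] c * p = p * Poly_Mapping.single [] c"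
proof (induction p rule: update_induct)
  case (update p k v)
  \<comment> \<open>The word \<open>k\<close> does not yet occur in \<open>p\<close>, so updating
    amounts to adding one monomial.\<close>
  have "Poly_Mapping.update k v p = p + Poly_Mapping.single k v"
    using update(1)
    by (intro poly_mapping_eqI)
      (auto simp: lookup_add lookup_update lookup_single in_keys_iff when_def)
  moreover have "Poly_Mapping.single [] c * Poly_Mapping.single k v =
      Poly_Mapping.single k v * Poly_Mapping.single [] c"
    by (simp add: mult_single plus_list_def mult.commute)
  ultimately show ?case
    using update by (simp add: distrib_left distrib_right)
qed simp

lemma scalars_central:
  assumes "k \<in> scalars n" and "z \<in> carrier (anticomm_ring n)"
  shows "k \<otimes>\<^bsub>anticomm_ring n\<^esub> z = z \<otimes>\<^bsub>anticomm_ring n\<^esub> k"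
proof -
  interpret h: ring_hom_ring "free_alg n" "anticomm_ring n"
      "(+>\<^bsub>free_alg n\<^esub>) (anticomm_ideal n)"
    by (rule ring_hom_coset)
  obtain c where k: "k = anticomm_ideal n +>\<^bsub>free_alg n\<^esub> Poly_Mapping.single [] c"
    using assms(1) by (auto simp: scalars_def)
  have "z \<in> a_rcosets\<^bsub>free_alg n\<^esub> anticomm_ideal n"
    using assms(2) by (simp only: anticomm_ring_def FactRing_def partial_object.simps)
  then obtain p where p: "p \<in> carrier (free_alg n)" and z: "z = anticomm_ideal n +>\<^bsub>free_alg n\<^esub> p"
    unfolding A_RCOSETS_def' by blast
  have c: "Poly_Mapping.single [] c \<in> carrier (free_alg n)"
    by (simp add: free_alg_def)
  have "Poly_Mapping.single [] c \<otimes>\<^bsub>free_alg n\<^esub> p = p \<otimes>\<^bsub>free_alg n\<^esub> Poly_Mapping.single [] c"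
    by (simp add: free_alg_def single_Nil_commute)
  then show ?thesis
    unfolding k z using h.hom_mult[OF p c] h.hom_mult[OF c p] by argo
qed

definition centralizer :: "('a, 'b) ring_scheme \<Rightarrow> 'a set \<Rightarrow> 'a set" where
  "centralizer R S = {z \<in> carrier R. \<forall>s\<in>S. z \<otimes>\<^bsub>R\<^esub> s = s \<otimes>\<^bsub>R\<^esub> z}"

lemma (in ring) mult_in_centralizer:
  assumes "S \<subseteq> carrier R" "y \<in> centralizer R S" "z \<in> centralizer R S"
  shows "y \<otimes> z \<in> centralizer R S"
proof -
  have "y \<otimes> z \<otimes> s = s \<otimes> (y \<otimes> z)" if "s \<in> S" for s
  proof -
    have [simp]: "s \<in> carrier R" "y \<in> carrier R" "z \<in> carrier R"
      using assms that by (auto simp: centralizer_def)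
    have "y \<otimes> z \<otimes> s = y \<otimes> s \<otimes> z"
      using assms(3) that by (simp add: centralizer_def m_assoc)
    also have "\<dots> = s \<otimes> (y \<otimes> z)"
      using assms(2) that by (simp add: centralizer_def m_assoc)
    finally show ?thesis .
  qed
  then show ?thesis
    using assms by (auto simp: centralizer_def)
qed

lemma (in ring) centralizer_subring:
  assumes "S \<subseteq> carrier R"
  shows "subring (centralizer R S) R"
proof (rule subringI)
  fix y z assume "y \<in> centralizer R S" "z \<in> centralizer R S"
  then show "y \<otimes> z \<in> centralizer R S"
    by (rule mult_in_centralizer[OF assms])
next
  fix z assume z: "z \<in> centralizer R S"
  then have "\<ominus> z \<otimes> s = s \<otimes> \<ominus> z" if "s \<in> S" for s
    using assms that l_minus[of z s] r_minus[of s z] by (auto simp: centralizer_def)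
  then show "\<ominus> z \<in> centralizer R S"
    using z by (simp add: centralizer_def)
next
  fix y z assume yz: "y \<in> centralizer R S" "z \<in> centralizer R S"
  then have "(y \<oplus> z) \<otimes> s = s \<otimes> (y \<oplus> z)" if "s \<in> S" for s
    using assms that l_distr[of y z s] r_distr[of y z s] by (auto simp: centralizer_def)
  then show "y \<oplus> z \<in> centralizer R S"
    using yz by (simp add: centralizer_def)
qed (use assms in \<open>auto simp: centralizer_def\<close>)

text \<open>With \<open>K\<close> inside the centralizer, closure under scalars is a case of closure
  under products.\<close>

lemma (in ring) centralizer_subalgebra:
  assumes "S \<subseteq> carrier R" "K \<subseteq> centralizer R S"
  shows "subalgebra K (centralizer R S) R"
  using subring.axioms(1)[OF centralizer_subring[OF assms(1)]] assms
  by (auto simp: subalgebra_def subalgebra_axioms_def intro: mult_in_centralizer)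

text \<open>Central scalars make the centralizer one of the subalgebras being intersected.\<close>

lemma generated_subalgebra_subset_centralizer:
  assumes "T \<subseteq> carrier (anticomm_ring n)" "S \<subseteq> centralizer (anticomm_ring n) T"
  shows "generated_subalgebra n S \<subseteq> centralizer (anticomm_ring n) T"
proof -
  interpret ring "anticomm_ring n" by (rule ring_anticomm_ring)
  have "scalars n \<subseteq> centralizer (anticomm_ring n) T"
    using assms(1) scalars_closed by (auto simp: centralizer_def intro!: scalars_central)
  then show ?thesis
    using assms centralizer_subring centralizer_subalgebra
    by (auto simp: generated_subalgebra_def)
qed

theorem corollary2p4:
  fixes n :: nat
  assumes "n \<ge> 1"
  shows "\<forall>x \<in> generated_subalgebra n (range (F_ones n)).
         \<forall>y \<in> generated_subalgebra n (range (F_ones n)).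
           x \<otimes>\<^bsub>anticomm_ring n\<^esub> y = y \<otimes>\<^bsub>anticomm_ring n\<^esub> x"
proof -
  let ?R = "anticomm_ring n" and ?S = "range (F_ones n)"
  let ?G = "generated_subalgebra n ?S"
  have S: "?S \<subseteq> carrier ?R"
    using F_ones_closed by blast
  have G: "?G \<subseteq> carrier ?R"
    by (rule subringE(1)[OF generated_subalgebra(1)[OF S]])
  have "?S \<subseteq> centralizer ?R ?S"
    using S by (auto simp: centralizer_def F_ones_commute)
  then have "?G \<subseteq> centralizer ?R ?S"
    by (rule generated_subalgebra_subset_centralizer[OF S])
  \<comment> \<open>Commuting is symmetric, so the roles of \<open>?S\<close> and \<open>?G\<close>
    can be exchanged before the second passage from generators to subalgebra.\<close>
  then have "?S \<subseteq> centralizer ?R ?G"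
    using S by (fastforce simp: centralizer_def)
  then have "?G \<subseteq> centralizer ?R ?G"
    by (rule generated_subalgebra_subset_centralizer[OF G])
  then show ?thesis
    by (auto simp: centralizer_def)
qed

end
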